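(* Let $\alpha\in\mathbb{R}\setminus(\mathfrak{L}\cup\mathbb{Q})$ and let $0<v<1$. There exist constants $r$, $C_1$ and $N_0$, depending on $\alpha$ and $v$ only, with $0<r,C_1<1$ and $N_0>1$, such that for any $\gamma\in\mathbb{R}$ and all integers $N>N_0$, $$\sum_{\substack{rN<n\le N\\ \|n\alpha-\gamma\|\ge N^{-v}}}\frac{1}{\|n\alpha-\gamma\|}\ \ge\ C_1N\log N.$$
   Context: $\|x\|$ denotes the distance from $x\in\mathbb{R}$ to the nearest integer. $\mathfrak{L}$ denotes the set of Liouville numbers, i.e. of $\alpha\in\mathbb{R}\setminus\mathbb{Q}$ such that $\liminf_{n\to\infty}n^w\|n\alpha\|=0$ for all $w>0$. *)

theory Defs
  imports "HOL-Analysis.Analysis"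
begin

definition int_dist :: "real \<Rightarrow> real" where
  "int_dist x = infdist x \<int>"

text \<open>
  The lower limit is taken in the extended reals, where it always exists.
\<close>

definition liouville_numbers :: "real set" where
  "liouville_numbers =
     {\<alpha>. \<alpha> \<notin> \<rat> \<and>
        (\<forall>w::real. w > 0 \<longrightarrow>
           liminf (\<lambda>n::nat. ereal (real n powr w * int_dist (real n * \<alpha>))) = 0)}"

lemma int_dist_eq_round: "int_dist x = \<bar>x - of_int (round x)\<bar>"
proof -
  have "(INF a\<in>\<int>. dist x a) = dist x (of_int (round x))"
  proof (rule cInf_eq_minimum)
    show "dist x (of_int (round x)) \<in> dist x ` \<int>" by auto
    show "dist x (of_int (round x)) \<le> y" if "y \<in> dist x ` \<int>" for y
      using that round_diff_minimal[of x] by (auto simp: dist_real_def elim!: Ints_cases)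
  qed
  moreover have "(\<int>::real set) \<noteq> {}" using Ints_0 by blast
  ultimately show ?thesis by (simp add: int_dist_def infdist_def dist_real_def)
qed

end

theory Submission
  imports Defs "HOL-Number_Theory.Cong"
begin

text \<open>
  Why the theorem holds. Take a reduced fraction \<open>p/q\<close> with \<open>\<bar>q\<alpha> - p\<bar> \<le> 1/q\<close>. Over \<open>q\<close>
  consecutive integers \<open>n\<close> the product \<open>n\<alpha>\<close> differs from an arithmetic progression with step
  \<open>p/q\<close> by less than \<open>1/q\<close>, and modulo 1 that progression runs once through a translate of
  \<open>{0, 1/q, \<dots>, (q-1)/q}\<close>. So, whatever \<open>\<gamma>\<close> is, the points \<open>n\<alpha> - \<gamma>\<close> of such a block have, up
  to a few points near \<open>0\<close> and \<open>1\<close>, fractional parts comparable to \<open>k/q\<close>, one for each \<open>k\<close>,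
  and the reciprocal distances sum to at least \<open>q (ln q - 2)\<close> by comparison with the
  harmonic series (lemma \<open>block_sum_ge\<close>). Only points at distance at least \<open>1/q\<close> are
  used for this bound, so a cut-off at \<open>N powr (-v)\<close> does no harm as long as
  \<open>q \<le> N powr v\<close>.

  Dirichlet's theorem provides such a \<open>q\<close> below \<open>N powr v\<close>, with
  \<open>\<bar>q\<alpha> - p\<bar>\<close> of order at most \<open>N powr (-v)\<close>. Since \<open>\<alpha>\<close> is neither rational nor a Liouville
  number, \<open>int_dist (q\<alpha>) \<ge> c * q powr (-w)\<close> for fixed \<open>c, w > 0\<close>; hence \<open>q\<close> is at least a
  constant times \<open>N powr (v/w)\<close>, and \<open>ln q\<close> is at least a constant multiple of \<open>ln N\<close>
  (lemma \<open>dirichlet_non_liouville\<close>). As \<open>v < 1\<close>, \<open>q\<close> is small compared to \<open>N\<close>, so disjoint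
  blocks of length \<open>q\<close> contain at least \<open>N/4\<close> integers of \<open>(N/2, N]\<close>. Adding up the
  blocks gives the bound with \<open>r = 1/2\<close>.
\<close>

section \<open>Distance to the nearest integer\<close>

lemma int_dist_le: "int_dist x \<le> \<bar>x - of_int l\<bar>"
  by (metis int_dist_def infdist_le Ints_of_int dist_real_def)

lemma int_dist_nonneg: "0 \<le> int_dist x"
  by (simp add: int_dist_eq_round)

lemma int_dist_pos:
  assumes "x \<notin> \<int>"
  shows "0 < int_dist x"
  using assms unfolding int_dist_eq_round
  by (metis Ints_of_int abs_eq_0 diff_eq_diff_eq diff_self zero_less_abs_iff)

lemma int_dist_ge:
  assumes "d \<le> x - of_int l" "x - of_int l \<le> 1 - d"
  shows "d \<le> int_dist x"
proof (cases "round x \<le> l")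
  case True
  then have "(of_int (round x) :: real) \<le> of_int l" by simp
  then show ?thesis using assms unfolding int_dist_eq_round by linarith
next
  case False
  then have "l + 1 \<le> round x" by simp
  then have "(of_int l + 1 :: real) \<le> of_int (round x)"
    by (metis of_int_1 of_int_add of_int_le_iff)
  then show ?thesis using assms unfolding int_dist_eq_round by linarith
qed

section \<open>Diophantine approximation of non-Liouville numbers\<close>

lemma irrational_multiple_not_int:
  assumes "\<alpha> \<notin> \<rat>" "n > 0"
  shows "real n * \<alpha> \<notin> \<int>"
proof
  assume "real n * \<alpha> \<in> \<int>"
  then have "real n * \<alpha> / real n \<in> \<rat>"
    by (intro Rats_divide) (auto simp: Ints_subset_Rats[THEN subsetD])
  then show False using assms by simp
qed

text \<open>
  The lower limit being nonzero for one \<open>w\<close> bounds \<open>n powr w * int_dist (n\<alpha>)\<close> away from 0 for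
  large \<open>n\<close>; the finitely many remaining values are positive because \<open>\<alpha>\<close> is irrational, so
  a minimum gives a constant valid for every positive \<open>n\<close>.
\<close>
lemma non_liouville_lower_bound:
  assumes "\<alpha> \<notin> liouville_numbers \<union> \<rat>"
  obtains w c where "w > 0" "c > 0"
    "\<And>n. n > 0 \<Longrightarrow> c \<le> real n powr w * int_dist (real n * \<alpha>)"
proof -
  have irr: "\<alpha> \<notin> \<rat>" using assms by auto
  obtain w where w: "w > 0"
    and ne: "liminf (\<lambda>n::nat. ereal (real n powr w * int_dist (real n * \<alpha>))) \<noteq> 0"
    using assms by (auto simp: liouville_numbers_def)
  define f where "f n = real n powr w * int_dist (real n * \<alpha>)" for n
  have "0 \<le> liminf (\<lambda>n. ereal (f n))"
    by (intro Liminf_bounded) (auto simp: f_def int_dist_nonneg)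
  with ne have "0 < liminf (\<lambda>n. ereal (f n))" by (auto simp: f_def)
  then obtain d where d: "0 < ereal d" "ereal d < liminf (\<lambda>n. ereal (f n))"
    using ereal_dense2 by blast
  from less_LiminfD[OF d(2)] obtain n0 where n0: "\<And>n. n \<ge> n0 \<Longrightarrow> d < f n"
    by (auto simp: eventually_sequentially)
  define c where "c = Min (insert d (f ` {1..<n0}))"
  have fpos: "0 < f n" if "n > 0" for n
    unfolding f_def using that irr by (intro mult_pos_pos int_dist_pos irrational_multiple_not_int) auto
  have "0 < c" unfolding c_def using d fpos by (subst Min_gr_iff) auto
  moreover have "c \<le> f n" if "n > 0" for n
  proof (cases "n < n0")
    case True
    then show ?thesis unfolding c_def using that by (intro Min_le) auto
  next
    case False
    have "c \<le> d" unfolding c_def by (intro Min_le) auto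
    with n0[of n] False show ?thesis by simp
  qed
  ultimately show thesis using that w by (auto simp: f_def)
qed

text \<open>
  The denominators of good approximations to \<open>\<alpha>\<close> cannot lie far apart: Dirichlet's theorem
  with bound \<open>X\<close> gives \<open>int_dist (q\<alpha>) < 2/X\<close>, and together with
  \<open>int_dist (q\<alpha>) \<ge> c * q powr (-w)\<close> this forces \<open>q powr w \<ge> c X / 2\<close>. The last conclusion
  is the logarithm of this inequality.
\<close>
lemma dirichlet_non_liouville:
  assumes bound: "\<And>n. n > 0 \<Longrightarrow> c \<le> real n powr w * int_dist (real n * \<alpha>)"
    and c: "0 < c" and w: "0 < w" and X: "1 \<le> X"
  obtains p :: int and q :: nat where "q > 0" "coprime p (int q)" "real q \<le> X"
    "\<bar>real q * \<alpha> - of_int p\<bar> \<le> 1 / real q"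
    "(ln X + ln (c / 2)) / w \<le> ln (real q)"
proof -
  define Q where "Q = nat \<lfloor>X\<rfloor>"
  have Q: "Q > 0" "real Q \<le> X" "X \<le> 2 * real Q"
  proof -
    have "1 \<le> \<lfloor>X\<rfloor>" using X by simp
    then have "real Q = of_int \<lfloor>X\<rfloor>" "Q > 0" unfolding Q_def by auto
    moreover have "of_int \<lfloor>X\<rfloor> \<le> X" "X < of_int \<lfloor>X\<rfloor> + 1" by linarith+
    ultimately show "Q > 0" "real Q \<le> X" "X \<le> 2 * real Q" by linarith+
  qed
  obtain p k where pk: "coprime p k" "0 < k" "k \<le> int Q" "\<bar>of_int k * \<alpha> - of_int p\<bar> < 1 / real Q"
    using Dirichlet_approx_coprime[OF Q(1), of \<alpha>] by metis
  define q where "q = nat k"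
  have q: "q > 0" "k = int q" "q \<le> Q" using pk by (auto simp: q_def)
  have ap: "\<bar>real q * \<alpha> - of_int p\<bar> < 1 / real Q" using pk(4) q(2) by simp
  have "c \<le> real q powr w * int_dist (real q * \<alpha>)" by (rule bound[OF q(1)])
  also have "\<dots> \<le> real q powr w * (1 / real Q)"
    using int_dist_le[of "real q * \<alpha>" p] ap by (intro mult_left_mono) auto
  finally have "c * real Q \<le> real q powr w" using Q(1) by (simp add: field_simps)
  moreover have "X * (c / 2) \<le> c * real Q" using mult_right_mono[OF Q(3), of "c/2"] c by (simp add: mult.commute)
  ultimately have "X * (c / 2) \<le> real q powr w" by linarith
  then have "ln (X * (c / 2)) \<le> ln (real q powr w)"
    using X c by (intro ln_mono) auto
  then have "ln X + ln (c / 2) \<le> w * ln (real q)"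
    using X c q(1) by (subst (asm) ln_mult) (auto simp: ln_powr)
  then have "(ln X + ln (c / 2)) / w \<le> ln (real q)"
    using w by (simp add: field_simps)
  moreover have "1 / real Q \<le> 1 / real q" using q by (intro divide_left_mono) auto
  ultimately show thesis
    using that[of q p] q pk ap Q by auto
qed

section \<open>Sums over blocks of consecutive multiples\<close>

text \<open>
  Moving the cut-off from the index set into the summand keeps the index sets intervals, so
  that they can be divided into blocks.
\<close>
definition trunc_recip :: "real \<Rightarrow> real \<Rightarrow> real" where
  "trunc_recip \<delta> x = (if \<delta> \<le> int_dist x then 1 / int_dist x else 0)"

lemma trunc_recip_nonneg: "0 \<le> trunc_recip \<delta> x"
  by (simp add: trunc_recip_def int_dist_nonneg)

text \<open>
  The sum is the harmonic sum up to \<open>q - 1\<close> without the terms \<open>1 + 1/2 + 1/3 < 2\<close>; for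
  \<open>q \<le> 4\<close> it is empty and the left-hand side is negative.
\<close>
lemma harmonic_tail_ge:
  assumes "q > 0"
  shows "ln (real q) - 2 \<le> (\<Sum>k\<in>{2..int q - 3}. 1 / (of_int k + 2))"
proof -
  have "ln (real q) \<le> harm (q - 1)"
    using ln_le_harm[of "q - 1"] assms by (simp add: of_nat_diff)
  also have "harm (q - 1) = (\<Sum>i\<in>{1..q-1}. 1 / real i)"
    by (simp add: harm_def field_simps)
  also have "\<dots> \<le> (\<Sum>i\<in>{1,2,3} \<union> {4..q-1}. 1 / real i)"
    by (rule sum_mono2) auto
  also have "\<dots> = (\<Sum>i\<in>{1,2,3::nat}. 1 / real i) + (\<Sum>i\<in>{4..q-1}. 1 / real i)"
    by (rule sum.union_disjoint) auto
  also have "(\<Sum>i\<in>{4..q-1}. 1 / real i) = (\<Sum>k\<in>{2..int q - 3}. 1 / (of_int k + 2))"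
    by (rule sum.reindex_bij_witness[of _ "\<lambda>k. nat (k + 2)" "\<lambda>i. int i - 2"]) auto
  finally show ?thesis by simp
qed

text \<open>
  Since \<open>p\<close> is invertible modulo \<open>q\<close>, each residue \<open>k\<close> modulo \<open>q\<close> is attained by
  \<open>j p + \<lfloor>q\<beta>\<rfloor>\<close> for exactly one \<open>j < q\<close>, called \<open>J k\<close> below. For this \<open>j\<close> the number
  \<open>q (\<beta> + j\<alpha>)\<close> lies strictly between \<open>k - 1\<close> and \<open>k + 2\<close> modulo \<open>q\<close>. For
  \<open>2 \<le> k \<le> q - 3\<close> the point \<open>\<beta> + j\<alpha>\<close> thus stays at distance at least \<open>1/q\<close> from the
  integers on both sides, so it survives the cut-off, and its reciprocal distance is at
  least \<open>q / (k + 2)\<close>.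
\<close>
lemma block_sum_ge:
  fixes \<alpha> \<beta> \<delta> :: real and p :: int and q :: nat
  assumes q: "q > 0" and cop: "coprime p (int q)"
    and approx: "\<bar>real q * \<alpha> - of_int p\<bar> \<le> 1 / real q"
    and \<delta>: "\<delta> \<le> 1 / real q"
  shows "real q * (ln (real q) - 2) \<le> (\<Sum>j<q. trunc_recip \<delta> (\<beta> + real j * \<alpha>))"
proof -
  define s where "s = \<lfloor>real q * \<beta>\<rfloor>"
  obtain u where u: "[p * u = 1] (mod int q)"
    using cop cong_solve_coprime_int by blast
  define J where "J k = nat ((k - s) * u mod int q)" for k
  have J: "int (J k) = (k - s) * u mod int q" "J k < q" for k
    using q by (auto simp: J_def nat_less_iff)
  have cong: "[int (J k) * p + s = k] (mod int q)" for k
  proof -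
    have "[int (J k) * p = (k - s) * u * p] (mod int q)"
      unfolding J(1) by (intro cong_scalar_right) simp
    also have "(k - s) * u * p = (k - s) * (p * u)" by simp
    also have "[\<dots> = (k - s) * 1] (mod int q)" by (intro cong_scalar_left u)
    finally have "[int (J k) * p + s = (k - s) * 1 + s] (mod int q)"
      by (rule cong_add_rcancel[THEN iffD2])
    then show ?thesis by simp
  qed
  have inj: "inj_on J {2..int q - 3}"
  proof (rule inj_onI)
    fix k k' assume k: "k \<in> {2..int q - 3}" "k' \<in> {2..int q - 3}" "J k = J k'"
    have "[k = k'] (mod int q)"
      using cong[of k] cong[of k'] k(3) by (metis cong_sym cong_trans)
    then show "k = k'" using k by (auto simp: cong_def)
  qed
  have summand_le: "real q / (of_int k + 2) \<le> trunc_recip \<delta> (\<beta> + real (J k) * \<alpha>)"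
    if k: "k \<in> {2..int q - 3}" for k
  proof -
    define x where "x = \<beta> + real (J k) * \<alpha>"
    obtain l where l: "int (J k) * p + s = k + int q * l"
      using cong[of k] by (metis cong_iff_lin cong_sym)
    (* e is the accumulated error of replacing j * alpha by j * p / q, scaled by q;
       t is the fractional part of q * beta. *)
    define e where "e = real (J k) * (real q * \<alpha> - of_int p)"
    have "\<bar>e\<bar> \<le> real (J k) * (1 / real q)"
      unfolding e_def abs_mult using approx by (intro mult_mono) auto
    also have "\<dots> < 1" using J(2)[of k] q by (simp add: field_simps)
    finally have e: "\<bar>e\<bar> < 1" .
    define t where "t = real q * \<beta> - of_int s"
    have t: "0 \<le> t" "t < 1" unfolding t_def s_def by linarith+
    have "real q * x = of_int (int (J k) * p + s) + t + e"
      by (simp add: x_def t_def e_def algebra_simps)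
    also have "\<dots> = of_int k + real q * of_int l + t + e"
      unfolding l by simp
    finally have eq: "x - of_int l = (of_int k + t + e) / real q"
      using q by (simp add: field_simps)
    have kr: "2 \<le> real_of_int k" "real_of_int k \<le> real q - 3"
      using k by auto
    have ge: "1 / real q \<le> int_dist x"
    proof (rule int_dist_ge)
      show "1 / real q \<le> x - of_int l"
        unfolding eq using kr t e by (intro divide_right_mono) auto
      have "(of_int k + t + e) / real q \<le> (real q - 1) / real q"
        using kr t e by (intro divide_right_mono) auto
      then show "x - of_int l \<le> 1 - 1 / real q"
        unfolding eq using q by (simp add: diff_divide_distrib)
    qed
    have pos: "0 < int_dist x" using ge q by (smt (verit) divide_pos_pos of_nat_0_less_iff)
    have "int_dist x \<le> \<bar>x - of_int l\<bar>" by (rule int_dist_le)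
    also have "\<dots> \<le> (of_int k + 2) / real q"
      unfolding eq abs_divide using kr t e by (intro frac_le) (use q in auto)
    finally have "real q / (of_int k + 2) \<le> 1 / int_dist x"
      using pos q kr by (simp add: field_simps)
    then show ?thesis
      using ge \<delta> by (simp add: trunc_recip_def x_def)
  qed
  have "real q * (ln (real q) - 2) \<le> real q * (\<Sum>k\<in>{2..int q - 3}. 1 / (of_int k + 2))"
    using harmonic_tail_ge[OF q] by (intro mult_left_mono) auto
  also have "\<dots> = (\<Sum>k\<in>{2..int q - 3}. real q / (of_int k + 2))"
    by (simp add: sum_distrib_left)
  also have "\<dots> \<le> (\<Sum>k\<in>{2..int q - 3}. trunc_recip \<delta> (\<beta> + real (J k) * \<alpha>))"
    by (intro sum_mono summand_le)
  also have "\<dots> = (\<Sum>j\<in>J ` {2..int q - 3}. trunc_recip \<delta> (\<beta> + real j * \<alpha>))"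
    by (simp add: sum.reindex[OF inj])
  also have "\<dots> \<le> (\<Sum>j<q. trunc_recip \<delta> (\<beta> + real j * \<alpha>))"
    using J(2) by (intro sum_mono2) (auto simp: trunc_recip_nonneg)
  finally show ?thesis .
qed

lemma blocks_sum_ge:
  fixes \<alpha> \<beta> \<delta> :: real and p :: int and q M :: nat
  assumes "q > 0" "coprime p (int q)"
    "\<bar>real q * \<alpha> - of_int p\<bar> \<le> 1 / real q" "\<delta> \<le> 1 / real q"
  shows "real (M * q) * (ln (real q) - 2) \<le> (\<Sum>i<M*q. trunc_recip \<delta> (\<beta> + real i * \<alpha>))"
proof -
  let ?g = "\<lambda>i. trunc_recip \<delta> (\<beta> + real i * \<alpha>)"
  have "real q * (ln (real q) - 2) \<le> sum ?g {m*q..<m*q+q}" for m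
  proof -
    have "sum ?g {m*q..<m*q+q} = (\<Sum>j<q. ?g (j + m*q))"
      using sum.shift_bounds_nat_ivl[of ?g 0 "m*q" q]
      by (simp add: add.commute lessThan_atLeast0)
    also have "\<dots> = (\<Sum>j<q. trunc_recip \<delta> ((\<beta> + real (m*q) * \<alpha>) + real j * \<alpha>))"
      by (simp add: algebra_simps)
    finally show ?thesis
      using block_sum_ge[OF assms, of "\<beta> + real (m*q) * \<alpha>"] by simp
  qed
  then have "(\<Sum>m<M. real q * (ln (real q) - 2)) \<le> (\<Sum>m<M. sum ?g {m*q..<m*q+q})"
    by (rule sum_mono)
  also have "\<dots> = sum ?g {..<M*q}" by (rule sum.nat_group)
  finally show ?thesis by (simp add: algebra_simps)
qed

section \<open>The lower bound for the sum\<close>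

theorem theorem1p7:
  fixes \<alpha> v :: real
  assumes "\<alpha> \<notin> liouville_numbers \<union> \<rat>"
    and "0 < v" and "v < 1"
  shows "\<exists>r C\<^sub>1 N\<^sub>0 :: real. 0 < r \<and> r < 1 \<and> 0 < C\<^sub>1 \<and> C\<^sub>1 < 1 \<and> 1 < N\<^sub>0 \<and>
    (\<forall>\<gamma>::real. \<forall>N::int. real_of_int N > N\<^sub>0 \<longrightarrow>
      (\<Sum>n | r * real_of_int N < real_of_int n \<and> n \<le> N \<and>
             int_dist (real_of_int n * \<alpha> - \<gamma>) \<ge> real_of_int N powr (- v).
         1 / int_dist (real_of_int n * \<alpha> - \<gamma>))
      \<ge> C\<^sub>1 * real_of_int N * ln (real_of_int N))"
proof -
  obtain w c where w: "w > 0" and c: "c > 0"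
    and bound: "\<And>n. n > 0 \<Longrightarrow> c \<le> real n powr w * int_dist (real n * \<alpha>)"
    using non_liouville_lower_bound[OF assms(1)] by blast
  (* ln q - 2 is at least 2 a ln N minus a constant; giving up half of the main term absorbs
     that constant for large N. The cap at 1/2 only ensures C < 1. *)
  define a where "a = v / (2 * w)"
  define C where "C = min (a / 4) (1 / 2)"
  have a: "0 < a" unfolding a_def using w assms by simp
  (* The first condition yields ln q - 2 >= a ln N, the second 4 q <= 4 N^v <= N. *)
  have "\<forall>\<^sub>F N in at_top. (2 - ln (c / 2) / w) / a \<le> ln (N::real)"
    using ln_at_top by (simp add: filterlim_at_top)
  moreover have "\<forall>\<^sub>F N in at_top. ln 4 / (1 - v) \<le> ln (N::real)"
    using ln_at_top by (simp add: filterlim_at_top)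
  ultimately have "\<forall>\<^sub>F N::real in at_top.
      (2 - ln (c / 2) / w) / a \<le> ln N \<and> ln 4 / (1 - v) \<le> ln N"
    by (rule eventually_conj)
  then obtain N1 where N1: "\<And>N. N \<ge> N1 \<Longrightarrow>
      (2 - ln (c / 2) / w) / a \<le> ln N \<and> ln 4 / (1 - v) \<le> ln N"
    by (auto simp: eventually_at_top_linorder)
  have "C * real_of_int N * ln (real_of_int N) \<le>
      (\<Sum>n | 1/2 * real_of_int N < real_of_int n \<and> n \<le> N \<and>
             int_dist (real_of_int n * \<alpha> - \<gamma>) \<ge> real_of_int N powr (- v).
         1 / int_dist (real_of_int n * \<alpha> - \<gamma>))"
    if N: "max N1 2 < real_of_int N" for \<gamma> :: real and N :: int
  proof -
    define X where "X = real_of_int N powr v"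
    have N2: "2 < real_of_int N" using N by simp
    have lnN: "0 < ln (real_of_int N)" using N2 by simp
    have large: "2 - ln (c / 2) / w \<le> a * ln (real_of_int N)"
      "ln 4 \<le> (1 - v) * ln (real_of_int N)"
      using N1[of "real_of_int N"] N a assms by (auto simp: field_simps)
    have X: "1 \<le> X" unfolding X_def using N2 assms by (intro ge_one_powr_ge_zero) auto
    have lnX: "ln X = v * ln (real_of_int N)" unfolding X_def using N2 by (simp add: ln_powr)
    obtain p :: int and q :: nat where q: "q > 0" "coprime p (int q)" "real q \<le> X"
      "\<bar>real q * \<alpha> - of_int p\<bar> \<le> 1 / real q"
      "(ln X + ln (c / 2)) / w \<le> ln (real q)"
      using dirichlet_non_liouville[OF bound c w X] by metis
    have "1 / X \<le> 1 / real q" using q X by (intro divide_left_mono) auto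
    then have \<delta>: "real_of_int N powr (- v) \<le> 1 / real q"
      by (simp add: X_def powr_minus_divide)
    have "(ln X + ln (c / 2)) / w = 2 * a * ln (real_of_int N) + ln (c / 2) / w"
      using w by (simp add: lnX a_def field_simps)
    with q(5) large have lnq: "a * ln (real_of_int N) \<le> ln (real q) - 2" by linarith
    have "ln (4 * real q) \<le> ln (real_of_int N)"
    proof -
      have "ln (real q) \<le> ln X" using q by (intro ln_mono) auto
      then have "ln 4 + ln (real q) \<le> ln (real_of_int N)"
        using large(2) unfolding lnX by (simp add: algebra_simps)
      then show ?thesis using q(1) by (simp add: ln_mult)
    qed
    then have qN: "4 * real q \<le> real_of_int N"
      using q(1) N2 by (subst (asm) ln_le_cancel_iff) auto
    (* M blocks of length q fit into (N/2, N]; rounding down costs at most a factor 2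
       because 4 q <= N. The blocks are counted downwards from N and start at b. *)
    define M where "M = nat N div (2 * q)"
    have rN: "real (nat N) = real_of_int N" using N2 by simp
    have "M * (2 * q) \<le> nat N" unfolding M_def by simp
    then have Mq_le: "2 * real (M * q) \<le> real_of_int N"
      by (metis (no_types, opaque_lifting) rN mult.left_commute of_nat_le_iff of_nat_mult of_nat_numeral)
    have "nat N < M * (2 * q) + 2 * q"
      unfolding M_def using q(1) by (metis add.commute dividend_less_times_div mult.commute mult_pos_pos zero_less_numeral)
    then have "real (nat N) < real (M * (2 * q) + 2 * q)" by (rule of_nat_less_iff[THEN iffD2])
    with qN rN have Mq_ge: "real_of_int N / 4 \<le> real (M * q)" by simp
    define b where "b = N - int (M * q) + 1"
    let ?\<delta> = "real_of_int N powr (- v)"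
    let ?S = "{n. 1/2 * real_of_int N < real_of_int n \<and> n \<le> N}"
    have fin: "finite ?S"
      by (rule finite_subset[of _ "{0..N}"]) (use N2 in auto)
    have "C * real_of_int N * ln (real_of_int N) \<le> a / 4 * real_of_int N * ln (real_of_int N)"
      using N2 lnN by (intro mult_right_mono) (auto simp: C_def)
    also have "\<dots> = real_of_int N / 4 * (a * ln (real_of_int N))" by simp
    also have "\<dots> \<le> real (M * q) * (ln (real q) - 2)"
      using Mq_ge lnq a lnN N2 by (intro mult_mono) auto
    also have "\<dots> \<le> (\<Sum>i<M*q. trunc_recip ?\<delta> ((of_int b * \<alpha> - \<gamma>) + real i * \<alpha>))"
      by (rule blocks_sum_ge[OF q(1,2,4) \<delta>])
    also have "\<dots> = (\<Sum>n\<in>{b..N}. trunc_recip ?\<delta> (of_int n * \<alpha> - \<gamma>))"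
      by (rule sum.reindex_bij_witness[of _ "\<lambda>n. nat (n - b)" "\<lambda>i. b + int i"])
        (auto simp: b_def algebra_simps simp del: of_nat_mult)
    also have "\<dots> \<le> (\<Sum>n\<in>?S. trunc_recip ?\<delta> (of_int n * \<alpha> - \<gamma>))"
    proof (rule sum_mono2[OF fin])
      have "real_of_int b = real_of_int N - real (M * q) + 1" by (simp add: b_def)
      then have "1/2 * real_of_int N < real_of_int b" using Mq_le by linarith
      then show "{b..N} \<subseteq> ?S" by (auto intro: less_le_trans)
    qed (auto simp: trunc_recip_nonneg)
    also have "\<dots> = (\<Sum>n\<in>{n\<in>?S. ?\<delta> \<le> int_dist (of_int n * \<alpha> - \<gamma>)}. 1 / int_dist (of_int n * \<alpha> - \<gamma>))"
      unfolding trunc_recip_def by (rule sum.inter_filter[OF fin, symmetric])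
    finally show ?thesis by (simp add: conj_assoc)
  qed
  moreover have "0 < C" "C < 1" using a by (auto simp: C_def)
  ultimately show ?thesis
    by (intro exI[of _ "1/2"] exI[of _ C] exI[of _ "max N1 2"]) auto
qed

end
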